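(* For all integers $p\ge1$, $$A^{(p)}(t,z)=\sum_{w\in Asc(p)}t^{|w|}z^{|w|_0}=1+\sum_{n\ge0}\binom{p-1+n}{n}\frac{zt}{(1-zt)^{n+1}}\prod_{i=1}^n\left(1-(1-t)^i\right).$$
   Context: For a finite integer sequence $(a_1,\dots,a_i)$, $\mathrm{asc}(a_1,\dots,a_i)=|\{j:1\le j<i,\ a_j<a_{j+1}\}|$. For an integer $p\ge1$, a $p$-ascent sequence of length $n\ge1$ is a sequence $(a_1,\dots,a_n)$ of nonnegative integers with $a_1=0$ and $a_i\le p+\mathrm{asc}(a_1,\dots,a_{i-1})$ for all $2\le i\le n$; the empty word is also a $p$-ascent sequence. $Asc(p)$ is the set of all $p$-ascent sequences, $|w|$ is the length of $w$ and $|w|_0$ the number of zeros in $w$. *)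

theory Defs
  imports "HOL-Analysis.Infinite_Sum" "HOL-Computational_Algebra.Formal_Power_Series"
begin

definition asc :: "nat list \<Rightarrow> nat" where
  "asc w = card {j. Suc j < length w \<and> w ! j < w ! Suc j}"

text \<open>Lists are 0-indexed: the entry \<open>a\<^sub>i\<close> is \<open>w ! (i - 1)\<close> and its prefix
  \<open>(a\<^sub>1, \<dots>, a\<^sub>i\<^sub>-\<^sub>1)\<close> is \<open>take (i - 1) w\<close>. The empty list is included.\<close>

definition Asc :: "nat \<Rightarrow> nat list set" where
  "Asc p = {w. (w \<noteq> [] \<longrightarrow> w ! 0 = 0) \<and>
               (\<forall>i. 1 \<le> i \<and> i < length w \<longrightarrow> w ! i \<le> p + asc (take i w))}"

text \<open>Formal power series in \<open>t\<close> and \<open>z\<close> are series in \<open>t\<close> whose coefficients are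
  series in \<open>z\<close>. The library topology on \<open>rat fps fps\<close> depends on the outer type only:
  it is the \<open>t\<close>-adic one, with all coefficient series in \<open>z\<close> compared exactly.
  Rational rather than integer coefficients make the library's division available.\<close>

definition t :: "rat fps fps" where
  "t = fps_X"

definition z :: "rat fps fps" where
  "z = fps_const fps_X"

definition A_gf :: "nat \<Rightarrow> rat fps fps" where
  "A_gf p = (\<Sum>\<^sub>\<infinity>w\<in>Asc p. t ^ length w * z ^ count_list w 0)"

end

theory Submission
  imports Defs
begin

text \<open>Let \<open>H m l\<close> count, by length and zeros, the continuations of a sequence with last entry \<open>l\<close>
  whose next entry may be at most \<open>m = p + asc\<close>. Then
  \<open>H m l = 1 + t (z H m 0 + (\<Sum>0<j\<le>l. H m j) + (\<Sum>l<j\<le>m. H (m + 1) j))\<close>, and this recursion determines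
  \<open>H\<close> coefficientwise in \<open>t\<close>. It is solved by
  \<open>H m l = \<Lambda> ((1 - x) powi (l - m) * (1 - (1 - t) x) powi (- l))\<close>, where \<open>\<Lambda>\<close> is linear over series in
  \<open>t, z\<close> and sends \<open>x ^ n\<close> to \<open>c n = (\<Prod>i=1..n. 1 - (1 - t) ^ i) / (1 - z t) ^ (n + 1)\<close>.
  Differences in \<open>l\<close> satisfy the recursion for every linear \<open>\<Lambda>\<close>; the case \<open>l = 0\<close> amounts to
  \<open>(1 - z t) c (n + 1) = (1 - (1 - t) ^ (n + 1)) c n\<close> and \<open>(1 - z t) c 0 = 1\<close>.
  Expanding \<open>1 + z t H p 0\<close> gives the claim.\<close>

unbundle fps_syntax

section \<open>Ascent sequences as a leading zero followed by a bounded continuation\<close>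

lemma asc_single [simp]: "asc [x] = 0"
  by (simp add: asc_def)

lemma asc_Cons_Cons: "asc (x # y # w) = (if x < y then 1 else 0) + asc (y # w)"
proof -
  let ?S = "{j. Suc j < length (y # w) \<and> (y # w) ! j < (y # w) ! Suc j}"
  have "{j. Suc j < length (x # y # w) \<and> (x # y # w) ! j < (x # y # w) ! Suc j}
      = (if x < y then {0} else {}) \<union> Suc ` ?S" (is "?A = ?B")
  proof (rule set_eqI)
    show "j \<in> ?A \<longleftrightarrow> j \<in> ?B" for j
      by (cases j) auto
  qed
  moreover have "finite ?S"
    by (rule finite_subset[of _ "{..<length (y # w)}"]) auto
  ultimately show ?thesis
    by (simp add: asc_def card_image)
qed

fun extends :: "nat \<Rightarrow> nat \<Rightarrow> nat list \<Rightarrow> bool" where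
  "extends m l [] \<longleftrightarrow> True"
| "extends m l (j # w) \<longleftrightarrow> j \<le> m \<and> extends (if l < j then Suc m else m) j w"

text \<open>Inserting \<open>j\<close> between \<open>l\<close> and the rest adds an ascent exactly
  when \<open>l < j\<close>; the recursion stores that ascent in the bound by passing from
  \<open>m\<close> to \<open>Suc m\<close>.\<close>

lemma extends_iff:
  "extends m l v \<longleftrightarrow> (\<forall>i<length v. v ! i \<le> m + asc (l # take i v))"
proof (induction v arbitrary: m l)
  case Nil
  then show ?case by simp
next
  case (Cons j v)
  have "(\<forall>i<length (j # v). (j # v) ! i \<le> m + asc (l # take i (j # v))) \<longleftrightarrow>
      j \<le> m \<and> (\<forall>i<length v. v ! i \<le> (if l < j then Suc m else m) + asc (j # take i v))"
    by (simp add: All_less_Suc2 asc_Cons_Cons)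
  then show ?case
    using Cons.IH by simp
qed

lemma Asc_Cons_iff: "a # v \<in> Asc p \<longleftrightarrow> a = 0 \<and> extends p 0 v"
proof -
  have "(\<forall>i. 1 \<le> i \<and> i < length (a # v) \<longrightarrow> (a # v) ! i \<le> p + asc (take i (a # v))) \<longleftrightarrow>
      (\<forall>i<length v. v ! i \<le> p + asc (a # take i v))" (is "?l \<longleftrightarrow> ?r")
  proof
    assume l: ?l
    show ?r
    proof (intro allI impI)
      fix i assume "i < length v"
      with l[rule_format, of "Suc i"] show "v ! i \<le> p + asc (a # take i v)"
        by simp
    qed
  next
    assume r: ?r
    show ?l
    proof (intro allI impI)
      fix i assume "1 \<le> i \<and> i < length (a # v)"
      with r show "(a # v) ! i \<le> p + asc (take i (a # v))"
        by (cases i) auto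
    qed
  qed
  then show ?thesis
    by (auto simp: Asc_def extends_iff)
qed

definition extensions :: "nat \<Rightarrow> nat \<Rightarrow> nat \<Rightarrow> nat list set" where
  "extensions m l k = {w. length w = k \<and> extends m l w}"

lemma extensions_0: "extensions m l 0 = {[]}"
  by (auto simp: extensions_def)

lemma extensions_Suc:
  "extensions m l (Suc k) =
    (\<Union>j\<le>m. (#) j ` extensions (if l < j then Suc m else m) j k)"
  by (auto simp: extensions_def length_Suc_conv image_iff)

lemma finite_extensions: "finite (extensions m l k)"
  by (induction k arbitrary: m l) (auto simp: extensions_0 extensions_Suc)

text \<open>The coefficient of \<open>t ^ k\<close> in \<open>H m l\<close>; here
  \<open>fps_X\<close> is the inner variable \<open>z\<close>.\<close>

definition extension_poly :: "nat \<Rightarrow> nat \<Rightarrow> nat \<Rightarrow> rat fps" where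
  "extension_poly m l k = (\<Sum>w\<in>extensions m l k. fps_X ^ count_list w 0)"

lemma extension_poly_0: "extension_poly m l 0 = 1"
  by (simp add: extension_poly_def extensions_0)

lemma extension_poly_Suc:
  "extension_poly m l (Suc k) =
    (\<Sum>j\<le>m. (if j = 0 then fps_X else 1) * extension_poly (if l < j then Suc m else m) j k)"
proof -
  have "extension_poly m l (Suc k) =
    (\<Sum>j\<le>m. \<Sum>w\<in>(#) j ` extensions (if l < j then Suc m else m) j k. fps_X ^ count_list w 0)"
    unfolding extension_poly_def extensions_Suc
    by (rule sum.UNION_disjoint) (auto simp: finite_extensions)
  also have "\<dots> =
    (\<Sum>j\<le>m. (if j = 0 then fps_X else 1) * extension_poly (if l < j then Suc m else m) j k)"
    by (intro sum.cong refl)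
      (auto simp: sum.reindex extension_poly_def sum_distrib_left o_def)
  finally show ?thesis .
qed

section \<open>Pairing a sequence of series with the coefficients of another series\<close>

text \<open>This is \<open>\<Sum>n. c n * Q $ n\<close> whenever \<open>c n\<close> is divisible by the \<open>n\<close>-th power of the variable:
  truncating at \<open>k\<close> then leaves the \<open>k\<close>-th coefficient unchanged.\<close>

definition coeff_pairing :: "(nat \<Rightarrow> 'a::comm_ring_1 fps) \<Rightarrow> 'a fps fps \<Rightarrow> 'a fps" where
  "coeff_pairing c Q = Abs_fps (\<lambda>k. (\<Sum>n\<le>k. c n * Q $ n) $ k)"

text \<open>One cutoff \<open>N\<close> thus serves all coefficients up to \<open>N\<close>, as
  needed when a product mixes several of them.\<close>

lemma coeff_pairing_nth:
  assumes "\<And>n. fps_X ^ n dvd c n" and "k \<le> N"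
  shows "coeff_pairing c Q $ k = (\<Sum>n\<le>N. c n * Q $ n) $ k"
proof -
  have "(c n * Q $ n) $ k = 0" if "k < n" for n
  proof -
    from assms(1)[of n] obtain d where "c n = fps_X ^ n * d" ..
    with that show ?thesis
      by (simp add: mult.assoc fps_X_power_mult_nth)
  qed
  then have "(\<Sum>n\<le>N. (c n * Q $ n) $ k) = (\<Sum>n\<le>k. (c n * Q $ n) $ k)"
    using assms(2) by (intro sum.mono_neutral_right) auto
  then show ?thesis
    by (simp add: coeff_pairing_def fps_sum_nth)
qed

lemma coeff_pairing_add: "coeff_pairing c (P + Q) = coeff_pairing c P + coeff_pairing c Q"
  by (rule fps_ext) (simp add: coeff_pairing_def distrib_left sum.distrib)

lemma coeff_pairing_diff: "coeff_pairing c (P - Q) = coeff_pairing c P - coeff_pairing c Q"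
  by (rule fps_ext) (simp add: coeff_pairing_def right_diff_distrib sum_subtractf)

lemma coeff_pairing_sum:
  "coeff_pairing c (\<Sum>i\<in>A. f i) = (\<Sum>i\<in>A. coeff_pairing c (f i))"
proof (induction A rule: infinite_finite_induct)
  case (insert i A)
  then show ?case by (simp add: coeff_pairing_add)
qed (simp_all add: coeff_pairing_def fps_eq_iff)

lemma coeff_pairing_const_mult:
  assumes "\<And>n. fps_X ^ n dvd c n"
  shows "coeff_pairing c (fps_const r * Q) = r * coeff_pairing c Q"
proof (rule fps_ext)
  fix k
  have "(r * coeff_pairing c Q) $ k = (\<Sum>i=0..k. r $ i * (\<Sum>n\<le>k. c n * Q $ n) $ (k - i))"
    by (simp add: fps_mult_nth coeff_pairing_nth[OF assms, of _ k])
  also have "\<dots> = (r * (\<Sum>n\<le>k. c n * Q $ n)) $ k"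
    by (simp add: fps_mult_nth)
  also have "\<dots> = coeff_pairing c (fps_const r * Q) $ k"
    by (simp add: coeff_pairing_def sum_distrib_left mult.left_commute)
  finally show "coeff_pairing c (fps_const r * Q) $ k = (r * coeff_pairing c Q) $ k" ..
qed

section \<open>Geometric series and their powers\<close>

definition geometric :: "'a::comm_ring_1 \<Rightarrow> 'a fps" where
  "geometric a = Abs_fps (\<lambda>n. a ^ n)"

lemma geometric_mult: "geometric a * (1 - fps_const a * fps_X) = 1"
proof -
  have "geometric a - fps_const a * (geometric a * fps_X) = 1"
    by (rule fps_ext) (simp add: geometric_def flip: power_Suc)
  then show ?thesis
    by (simp add: algebra_simps)
qed

text \<open>As \<open>geometric a\<close> is 1/(1 - a x), multiplying a power of it by 1 - a x
  lowers the exponent by one; on coefficients this is Pascal's rule.\<close>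

lemma geometric_power_Suc_nth:
  "(geometric a ^ Suc m) $ n = of_nat ((m + n) choose n) * a ^ n"
proof (induction m arbitrary: n)
  case 0
  then show ?case by (simp add: geometric_def)
next
  case (Suc m)
  note m_IH = Suc.IH
  have "geometric a ^ Suc (Suc m) * (1 - fps_const a * fps_X)
      = geometric a ^ Suc m * (geometric a * (1 - fps_const a * fps_X))"
    by (simp add: mult_ac)
  then have step: "geometric a ^ Suc (Suc m)
      = geometric a ^ Suc m + fps_const a * (geometric a ^ Suc (Suc m) * fps_X)"
    by (simp only: geometric_mult) (simp add: algebra_simps)
  show ?case
  proof (induction n)
    case 0
    show ?case by (subst step) (simp add: m_IH del: power_Suc)
  next
    case (Suc n)
    have "(geometric a ^ Suc (Suc m)) $ Suc n
        = (geometric a ^ Suc m) $ Suc n + a * (geometric a ^ Suc (Suc m)) $ n"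
      by (subst step) simp
    then show ?case
      unfolding Suc.IH m_IH by (simp add: algebra_simps)
  qed
qed

text \<open>Over the common denominator the numerator is (1 - b x) - (1 - a x) = (a - b) x.\<close>

lemma geometric_diff:
  "geometric a - geometric b = fps_const (a - b) * fps_X * geometric a * geometric b"
proof -
  let ?p = "1 - fps_const a * fps_X" and ?q = "1 - fps_const b * fps_X"
  have "geometric a - geometric b = geometric a * (geometric b * ?q) - (geometric a * ?p) * geometric b"
    by (simp add: geometric_mult)
  also have "\<dots> = geometric a * geometric b * (?q - ?p)"
    by (simp add: algebra_simps)
  also have "?q - ?p = fps_const (a - b) * fps_X"
    by (simp add: algebra_simps flip: fps_const_sub)
  finally show ?thesis by (simp add: mult_ac)
qed

section \<open>The weights \<open>c n\<close>\<close>

definition zt_inv :: "rat fps fps" where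
  "zt_inv = inverse (1 - z * t)"

lemma zt_nth_0: "(1 - z * t) $ 0 = 1"
  by (simp add: t_def)

text \<open>The coefficient ring \<open>'a fps\<close> is not a field, but the constant term 1 is
  its own inverse there, which makes \<open>g\<close> a unit.\<close>

lemma mult_inverse_fps_fps:
  fixes g :: "'a::field fps fps"
  assumes "g $ 0 = 1"
  shows "g * inverse g = 1"
proof -
  have "inverse (1 :: 'a fps) = 1"
    by (simp add: fps_inverse_one')
  then show ?thesis
    unfolding fps_inverse_def assms by (intro fps_right_inverse) (simp add: assms)
qed

lemma zt_inv_mult: "(1 - z * t) * zt_inv = 1"
  unfolding zt_inv_def by (rule mult_inverse_fps_fps[OF zt_nth_0])

lemma divide_zt_power: "a / (1 - z * t) ^ n = a * zt_inv ^ n"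
proof -
  let ?g = "(1 - z * t) ^ n"
  have g0: "?g $ 0 = 1"
    by (simp only: fps_power_zeroth zt_nth_0 power_one)
  have "zt_inv ^ n = zt_inv ^ n * (?g * inverse ?g)"
    by (simp only: mult_inverse_fps_fps[OF g0] mult_1_right)
  also have "\<dots> = ((1 - z * t) * zt_inv) ^ n * inverse ?g"
    by (simp only: power_mult_distrib mult_ac)
  finally have inv: "zt_inv ^ n = inverse ?g"
    by (simp only: zt_inv_mult power_one mult_1_left)
  have "?g $ 0 \<noteq> 0"
    unfolding g0 by simp
  then have "a / ?g = a * inverse ?g"
    by (rule fps_divide_unit)
  then show ?thesis
    unfolding inv .
qed

definition weight :: "nat \<Rightarrow> rat fps fps" where
  "weight n = zt_inv ^ Suc n * (\<Prod>i=1..n. 1 - (1 - t) ^ i)"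

lemma weight_0: "(1 - z * t) * weight 0 = 1"
  by (simp add: weight_def zt_inv_mult)

lemma weight_Suc: "(1 - z * t) * weight (Suc n) = (1 - (1 - t) ^ Suc n) * weight n"
proof -
  have "(1 - z * t) * weight (Suc n)
      = ((1 - z * t) * zt_inv) * ((1 - (1 - t) ^ Suc n) * weight n)"
    by (simp add: weight_def mult_ac del: power_Suc) (simp add: mult_ac)
  then show ?thesis
    by (simp only: zt_inv_mult mult_1_left)
qed

text \<open>Each of the \<open>n\<close> factors 1 - (1 - t)^i is divisible by 1 - (1 - t) =
  t.\<close>

lemma fps_X_power_dvd_weight: "fps_X ^ n dvd weight n"
proof -
  have "t dvd 1 - (1 - t) ^ i" for i
    using one_diff_power_eq[of "1 - t" i] by simp
  then have "(\<Prod>i=1..n. t) dvd (\<Prod>i=1..n. 1 - (1 - t) ^ i)"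
    by (intro prod_dvd_prod)
  then show ?thesis
    by (simp add: weight_def t_def)
qed

section \<open>Solving the recursion\<close>

definition kernel :: "nat \<Rightarrow> nat \<Rightarrow> rat fps fps fps" where
  "kernel m l = geometric 1 ^ (m - l) * geometric (1 - t) ^ l"

text \<open>The candidate for \<open>H m l\<close> when \<open>l \<le> m\<close>: the outermost
  variable of \<open>kernel\<close> is the auxiliary x, and the pairing replaces each
  \<open>x ^ n\<close> by \<open>weight n\<close>.\<close>

definition ext_gf :: "nat \<Rightarrow> nat \<Rightarrow> rat fps fps" where
  "ext_gf m l = coeff_pairing weight (kernel m l)"

lemma ext_gf_step:
  assumes "l < m"
  shows "ext_gf m (Suc l) - ext_gf m l = t * (ext_gf m (Suc l) - ext_gf (Suc m) (Suc l))"
proof -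
  let ?a = "geometric 1 :: rat fps fps fps" and ?b = "geometric (1 - t)"
  let ?k = "?a ^ (m - Suc l) * ?b ^ l"
  have m: "m - l = Suc (m - Suc l)"
    using assms by simp
  \<comment> \<open>The three kernels involved are \<open>?k * ?b\<close>, \<open>?k * ?a\<close>
    and \<open>?k * ?a * ?b\<close>, so this identity without \<open>?k\<close> is the whole
    claim.\<close>
  have "?b - ?a = fps_const t * (?b - ?a * ?b)"
  proof -
    have "?a - ?b = fps_const t * fps_X * ?a * ?b"
      using geometric_diff[of 1 "1 - t"] by simp
    moreover have "?a - 1 = fps_X * ?a"
      using geometric_mult[of "1 :: rat fps fps"] by (simp add: algebra_simps)
    ultimately have "?a - ?b = fps_const t * ((?a - 1) * ?b)"
      by (simp add: mult_ac)
    then show ?thesis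
      by (simp add: algebra_simps)
  qed
  then have "?k * (?b - ?a) = fps_const t * (?k * (?b - ?a * ?b))"
    by (simp add: mult_ac)
  then have "kernel m (Suc l) - kernel m l
      = fps_const t * (kernel m (Suc l) - kernel (Suc m) (Suc l))"
    by (simp add: kernel_def m algebra_simps)
  then have "coeff_pairing weight (kernel m (Suc l) - kernel m l)
      = coeff_pairing weight (fps_const t * (kernel m (Suc l) - kernel (Suc m) (Suc l)))"
    by simp
  then show ?thesis
    by (simp only: coeff_pairing_diff coeff_pairing_const_mult[OF fps_X_power_dvd_weight]
      ext_gf_def)
qed

lemma ext_gf_boundary:
  "(1 - z * t) * ext_gf m 0 = 1 + t * (\<Sum>j=1..m. ext_gf (Suc m) j)"
proof (rule fps_ext)
  fix k
  let ?a = "geometric 1 :: rat fps fps fps" and ?b = "geometric (1 - t)"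
  let ?S = "fps_const t * (\<Sum>j=1..m. kernel (Suc m) j)"
  \<comment> \<open>Substituting (1 - t) x for x turns \<open>?a\<close> into \<open>?b\<close> and
    multiplies the coefficient of \<open>x ^ n\<close> by \<open>(1 - t) ^ n\<close>.\<close>
  have nth: "(?a ^ m) $ n * (1 - (1 - t) ^ n) = (?a ^ m - ?b ^ m) $ n" for n
    by (cases m) (simp_all add: geometric_power_Suc_nth algebra_simps del: power_Suc)
  have "?a ^ m - ?b ^ m = (?a - ?b) * (\<Sum>i<m. ?b ^ (m - Suc i) * ?a ^ i)"
    by (rule power_diff_sumr2)
  also have "\<dots> = fps_X * ?S"
  proof -
    have "(\<Sum>j=1..m. kernel (Suc m) j) = ?a * ?b * (\<Sum>i<m. ?b ^ (m - Suc i) * ?a ^ i)"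
      unfolding sum_distrib_left
      by (rule sum.reindex_bij_witness[of _ "\<lambda>i. m - i" "\<lambda>j. m - j"])
        (auto simp: kernel_def Suc_diff_le mult_ac simp flip: power_Suc)
    moreover have "?a - ?b = fps_const t * fps_X * ?a * ?b"
      using geometric_diff[of 1 "1 - t"] by simp
    ultimately show ?thesis
      by (simp only: mult_ac)
  qed
  finally have S: "?S $ n = (1 - (1 - t) ^ Suc n) * (?a ^ m) $ Suc n" for n
    using nth[of "Suc n"] by (simp add: mult.commute)
  \<comment> \<open>The cutoff is \<open>Suc k\<close> because splitting off \<open>n = 0\<close>
    and shifting by \<open>weight_Suc\<close> leaves a sum up to \<open>k\<close>, the cutoff in the
    definition of \<open>coeff_pairing\<close>.\<close>
  have "((1 - z * t) * ext_gf m 0) $ k = ((1 - z * t) * (\<Sum>n\<le>Suc k. weight n * (?a ^ m) $ n)) $ k"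
    by (simp add: ext_gf_def kernel_def fps_mult_nth coeff_pairing_nth[OF fps_X_power_dvd_weight, of _ "Suc k"]
      del: sum.atMost_Suc)
  also have "(1 - z * t) * (\<Sum>n\<le>Suc k. weight n * (?a ^ m) $ n)
      = (\<Sum>n\<le>Suc k. ((1 - z * t) * weight n) * (?a ^ m) $ n)"
    by (simp only: sum_distrib_left mult.assoc)
  also have "\<dots> = (?a ^ m) $ 0 + (\<Sum>n\<le>k. ((1 - z * t) * weight (Suc n)) * (?a ^ m) $ Suc n)"
    by (subst sum.atMost_Suc_shift) (simp only: weight_0 mult_1_left)
  also have "\<dots> = 1 + (\<Sum>n\<le>k. weight n * ?S $ n)"
    by (simp only: S weight_Suc) (simp add: fps_power_zeroth geometric_def mult_ac)
  also have "\<dots> $ k = (1 + coeff_pairing weight ?S) $ k"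
    by (simp add: coeff_pairing_def)
  also have "coeff_pairing weight ?S = t * (\<Sum>j=1..m. ext_gf (Suc m) j)"
    by (simp only: coeff_pairing_sum coeff_pairing_const_mult[OF fps_X_power_dvd_weight] ext_gf_def)
  finally show "((1 - z * t) * ext_gf m 0) $ k = (1 + t * (\<Sum>j=1..m. ext_gf (Suc m) j)) $ k" .
qed

lemma ext_gf_rec:
  assumes "l \<le> m"
  shows "ext_gf m l = 1 + t * (\<Sum>j\<le>m. (if j = 0 then z else 1) * ext_gf (if l < j then Suc m else m) j)"
  using assms
proof (induction l)
  case 0
  have "(\<Sum>j\<le>m. (if j = 0 then z else 1) * ext_gf (if 0 < j then Suc m else m) j)
      = z * ext_gf m 0 + (\<Sum>j=1..m. ext_gf (Suc m) j)"
    by (simp add: atMost_atLeast0 sum.atLeast_Suc_atMost)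
  then show ?case
    using ext_gf_boundary[of m] by (simp add: algebra_simps)
next
  case (Suc l)
  let ?f = "\<lambda>l j. (if j = 0 then z else 1) * ext_gf (if l < j then Suc m else m) j"
  \<comment> \<open>Raising the last entry from \<open>l\<close> to \<open>Suc l\<close> changes
    only the summand \<open>j = Suc l\<close>, which stops being an ascent.\<close>
  have "(\<Sum>j\<le>m. ?f (Suc l) j - ?f l j) =
      (\<Sum>j\<le>m. if j = Suc l then ext_gf m (Suc l) - ext_gf (Suc m) (Suc l) else 0)"
    by (intro sum.cong) auto
  also have "\<dots> = ext_gf m (Suc l) - ext_gf (Suc m) (Suc l)"
    using Suc.prems by simp
  finally have "(\<Sum>j\<le>m. ?f (Suc l) j) - (\<Sum>j\<le>m. ?f l j) = ext_gf m (Suc l) - ext_gf (Suc m) (Suc l)"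
    by (simp only: sum_subtractf)
  then have "t * (\<Sum>j\<le>m. ?f (Suc l) j) - t * (\<Sum>j\<le>m. ?f l j) = ext_gf m (Suc l) - ext_gf m l"
    using ext_gf_step[of l m] Suc.prems by (simp only: right_diff_distrib[symmetric])
  moreover have "ext_gf m l = 1 + t * (\<Sum>j\<le>m. ?f l j)"
    using Suc by simp
  ultimately show ?case
    by (simp add: algebra_simps)
qed

text \<open>Both sides obey the same recursion, whose factor \<open>t\<close> reduces coefficient
  \<open>Suc k\<close> to coefficients \<open>k\<close>; the new pairs again have last entry at most
  the bound.\<close>

lemma ext_gf_nth: "l \<le> m \<Longrightarrow> ext_gf m l $ k = extension_poly m l k"
proof (induction k arbitrary: m l)
  case 0
  then show ?case
    by (subst ext_gf_rec) (simp_all add: t_def extension_poly_0)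
next
  case (Suc k)
  have "ext_gf m l $ Suc k =
      (\<Sum>j\<le>m. ((if j = 0 then z else 1) * ext_gf (if l < j then Suc m else m) j) $ k)"
    by (subst ext_gf_rec[OF Suc.prems]) (simp add: t_def fps_sum_nth)
  also have "\<dots> = (\<Sum>j\<le>m. (if j = 0 then fps_X else 1) * ext_gf (if l < j then Suc m else m) j $ k)"
    by (intro sum.cong) (auto simp: z_def)
  also have "\<dots> = extension_poly m l (Suc k)"
    unfolding extension_poly_Suc by (intro sum.cong) (simp_all add: Suc.IH)
  finally show ?case .
qed

section \<open>Summation over \<open>Asc p\<close> and over \<open>n\<close>\<close>

definition words :: "nat \<Rightarrow> nat \<Rightarrow> nat list set" where
  "words p k = {w \<in> Asc p. length w = k}"

lemma words_subset: "words p k \<subseteq> Asc p"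
  by (auto simp: words_def)

lemma words_0: "words p 0 = {[]}"
  by (auto simp: words_def Asc_def)

lemma words_Suc: "words p (Suc k) = (#) 0 ` extensions p 0 k"
  by (auto simp: words_def extensions_def length_Suc_conv Asc_Cons_iff image_iff)

lemma finite_words: "finite (words p k)"
  by (cases k) (simp_all add: words_0 words_Suc finite_extensions)

text \<open>The empty word gives the 1, and the leading zero of any other word gives the factor
  \<open>z * t\<close>.\<close>

lemma Asc_gf_nth:
  "(1 + z * t * ext_gf p 0) $ k = (\<Sum>w\<in>words p k. fps_X ^ count_list w 0)"
proof (cases k)
  case 0
  then show ?thesis by (simp add: words_0 t_def)
next
  case (Suc k')
  have "(z * t * ext_gf p 0) = fps_const fps_X * (fps_X * ext_gf p 0)"
    by (simp only: z_def t_def mult.assoc)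
  then have "(1 + z * t * ext_gf p 0) $ k = fps_X * extension_poly p 0 k'"
    by (simp only: Suc) (simp add: ext_gf_nth)
  then show ?thesis
    by (simp add: Suc words_Suc sum.reindex extension_poly_def sum_distrib_left o_def)
qed

lemma word_monomial_nth:
  "(t ^ length w * z ^ count_list w 0) $ k = (if length w = k then fps_X ^ count_list w 0 else 0)"
  by (simp add: t_def z_def fps_const_power fps_X_power_mult_nth)

text \<open>For t-adic convergence it suffices that each coefficient becomes constant: coefficient
  \<open>k\<close> is final once a finite set contains the finitely many words of length
  \<open>k\<close>.\<close>

lemma has_sum_Asc:
  "((\<lambda>w. t ^ length w * z ^ count_list w 0) has_sum 1 + z * t * ext_gf p 0) (Asc p)"
  unfolding has_sum_def
proof (rule tendsto_fpsI)
  fix k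
  have "(\<Sum>w\<in>F. t ^ length w * z ^ count_list w 0) $ k = (1 + z * t * ext_gf p 0) $ k"
    if "finite F" "words p k \<subseteq> F" "F \<subseteq> Asc p" for F
  proof -
    have "(\<Sum>w\<in>F. t ^ length w * z ^ count_list w 0) $ k
        = (\<Sum>w\<in>F. if length w = k then fps_X ^ count_list w 0 else 0)"
      by (simp add: fps_sum_nth word_monomial_nth)
    also have "\<dots> = (\<Sum>w\<in>words p k. fps_X ^ count_list w 0)"
      using that by (intro sum.mono_neutral_cong_right) (auto simp: words_def)
    finally show ?thesis by (simp only: Asc_gf_nth)
  qed
  then show "\<forall>\<^sub>F F in finite_subsets_at_top (Asc p).
      (\<Sum>w\<in>F. t ^ length w * z ^ count_list w 0) $ k = (1 + z * t * ext_gf p 0) $ k"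
    unfolding eventually_finite_subsets_at_top
    using finite_words[of p k] words_subset[of p k] by blast
qed

lemma sums_ext_gf:
  assumes "p \<ge> 1"
  shows "(\<lambda>n. of_nat ((p - 1 + n) choose n) * (z * t / (1 - z * t) ^ (n + 1))
                    * (\<Prod>i=1..n. 1 - (1 - t) ^ i)) sums (z * t * ext_gf p 0)"
proof -
  \<comment> \<open>\<open>kernel p 0\<close> is (1 - x)^(-p); writing \<open>p\<close> as
    \<open>Suc (p - 1)\<close> identifies the binomial coefficient as its coefficient of
    \<open>x ^ n\<close>.\<close>
  have term_eq: "of_nat ((p - 1 + n) choose n) * (z * t / (1 - z * t) ^ (n + 1))
      * (\<Prod>i=1..n. 1 - (1 - t) ^ i) = z * t * (weight n * kernel p 0 $ n)" for n
    using geometric_power_Suc_nth[of "1 :: rat fps fps" "p - 1" n] assms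
    by (simp only: divide_zt_power) (simp add: weight_def kernel_def mult_ac del: power_Suc)
  show ?thesis
    unfolding sums_def_le term_eq
  proof (rule tendsto_fpsI)
    fix k
    \<comment> \<open>As \<open>weight n\<close> is divisible by \<open>t ^ n\<close>, terms beyond
      \<open>k\<close> do not reach coefficient \<open>k\<close>.\<close>
    have "(\<Sum>n\<le>N. z * t * (weight n * kernel p 0 $ n)) $ k = (z * t * ext_gf p 0) $ k"
      if "N \<ge> k" for N
    proof -
      have "(z * t * ext_gf p 0) $ k = (z * t * (\<Sum>n\<le>N. weight n * kernel p 0 $ n)) $ k"
        unfolding ext_gf_def fps_mult_nth[of "z * t"] using that
        by (intro sum.cong) (simp_all add: coeff_pairing_nth[OF fps_X_power_dvd_weight, of _ N])
      then show ?thesis by (simp only: sum_distrib_left)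
    qed
    then show "\<forall>\<^sub>F N in sequentially.
        (\<Sum>n\<le>N. z * t * (weight n * kernel p 0 $ n)) $ k = (z * t * ext_gf p 0) $ k"
      unfolding eventually_sequentially by blast
  qed
qed

theorem theorem3p4:
  fixes p :: nat
  assumes "p \<ge> 1"
  shows "((\<lambda>w. t ^ length w * z ^ count_list w 0) has_sum A_gf p) (Asc p) \<and>
    summable (\<lambda>n. of_nat ((p - 1 + n) choose n) * (z * t / (1 - z * t) ^ (n + 1))
                    * (\<Prod>i=1..n. 1 - (1 - t) ^ i)) \<and>
    A_gf p = 1 + (\<Sum>n. of_nat ((p - 1 + n) choose n) * (z * t / (1 - z * t) ^ (n + 1))
                    * (\<Prod>i=1..n. 1 - (1 - t) ^ i))"
proof -
  have "A_gf p = 1 + z * t * ext_gf p 0"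
    unfolding A_gf_def by (rule infsumI[OF has_sum_Asc])
  then show ?thesis
    using has_sum_Asc[of p] sums_ext_gf[OF assms]
    by (simp only: sums_unique[symmetric] sums_summable simp_thms)
qed

end
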